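(* Let $\gamma:\mathbb{R}^d\to\mathbb{R}$ be a gauge. If isosceles orthogonality is a symmetric relation (i.e., for all $x,y\in\mathbb{R}^d$, $x\perp_I y$ implies $y\perp_I x$), then $\gamma$ is a norm.
   Context: A gauge is a function $\gamma:\mathbb{R}^d\to\mathbb{R}$ such that $\gamma(x)\geq 0$ for all $x$, $\gamma(x)=0$ implies $x=0$, $\gamma(\lambda x)=\lambda\gamma(x)$ for all $\lambda>0$, and $\gamma(x+y)\leq\gamma(x)+\gamma(y)$ (it need not be symmetric). A point $y\in\mathbb{R}^d$ is isosceles orthogonal to $x\in\mathbb{R}^d$, written $y\perp_I x$, if $\gamma(y+x)=\gamma(y-x)$. *)

theory Defs
  imports "HOL-Analysis.Analysis"
begin

definition gauge_on_space :: "(real ^ 'd \<Rightarrow> real) \<Rightarrow> bool" where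
  "gauge_on_space \<gamma> \<longleftrightarrow>
     (\<forall>x. 0 \<le> \<gamma> x) \<and>
     (\<forall>x. \<gamma> x = 0 \<longrightarrow> x = 0) \<and>
     (\<forall>x c. 0 < c \<longrightarrow> \<gamma> (c *\<^sub>R x) = c * \<gamma> x) \<and>
     (\<forall>x y. \<gamma> (x + y) \<le> \<gamma> x + \<gamma> y)"

text \<open>\<open>isosceles_orthogonal \<gamma> y x\<close> is the relation $y \perp_I x$. The order of the
  arguments matters, as a gauge need not satisfy \<open>\<gamma> (y - x) = \<gamma> (x - y)\<close>.\<close>

definition isosceles_orthogonal :: "(real ^ 'd \<Rightarrow> real) \<Rightarrow> real ^ 'd \<Rightarrow> real ^ 'd \<Rightarrow> bool" where
  "isosceles_orthogonal \<gamma> y x \<longleftrightarrow> \<gamma> (y + x) = \<gamma> (y - x)"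

text \<open>HOL-Analysis has norms only as the type class operation \<open>norm\<close>; this is the
  predicate form of the norm axioms for an arbitrary function.\<close>

definition is_norm :: "(real ^ 'd \<Rightarrow> real) \<Rightarrow> bool" where
  "is_norm \<gamma> \<longleftrightarrow>
     (\<forall>x. 0 \<le> \<gamma> x) \<and>
     (\<forall>x. \<gamma> x = 0 \<longleftrightarrow> x = 0) \<and>
     (\<forall>x c. \<gamma> (c *\<^sub>R x) = \<bar>c\<bar> * \<gamma> x) \<and>
     (\<forall>x y. \<gamma> (x + y) \<le> \<gamma> x + \<gamma> y)"

end

theory Submission
  imports Defs
begin

text \<open>A gauge can fall short of a norm only by being asymmetric, so evenness suffices. Testing
  the symmetry of orthogonality on pairs with one vector zero already yields it.\<close>

theorem corollary4p3:
  fixes \<gamma> :: "real ^ 'd \<Rightarrow> real"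
  assumes "gauge_on_space \<gamma>"
    and "\<forall>x y. isosceles_orthogonal \<gamma> x y \<longrightarrow> isosceles_orthogonal \<gamma> y x"
  shows "is_norm \<gamma>"
proof -
  have nonneg: "0 \<le> \<gamma> x" and definite: "\<gamma> x = 0 \<Longrightarrow> x = 0"
    and homogeneous: "0 < c \<Longrightarrow> \<gamma> (c *\<^sub>R x) = c * \<gamma> x"
    and triangle: "\<gamma> (x + y) \<le> \<gamma> x + \<gamma> y" for x y c
    using assms(1) by (auto simp: gauge_on_space_def)
  \<comment> \<open>Scaling fixes the origin, so \<open>\<gamma> 0 = 2 * \<gamma> 0\<close>; any
    positive factor other than 1 would do.\<close>
  have zero: "\<gamma> 0 = 0"
    using homogeneous[of 2 0] by simp
  \<comment> \<open>Every vector is isosceles orthogonal to 0; the converse relation says that \<open>\<gamma>\<close> is even.\<close>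
  have even: "\<gamma> (- x) = \<gamma> x" for x
    using assms(2)[rule_format, of x 0] by (simp add: isosceles_orthogonal_def)
  have "\<gamma> (c *\<^sub>R x) = \<bar>c\<bar> * \<gamma> x" for x c
  proof (cases c "0 :: real" rule: linorder_cases)
    \<comment> \<open>Evenness trades \<open>c\<close> for the positive factor
      \<open>- c\<close>.\<close>
    case less
    then show ?thesis
      using homogeneous[of "- c" x] even[of "c *\<^sub>R x"] by simp
  qed (simp_all add: zero homogeneous)
  then show ?thesis
    using nonneg definite zero triangle by (auto simp: is_norm_def)
qed

end
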